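(* For every countable field $F$, $\mathrm{non}(\mathcal{M})\leq\mathfrak{a}_{\mathrm{vec},F}$.
   Context: $F$ is a countable (possibly finite) field, $E$ is a vector space over $F$ of countably infinite dimension, and $(e_n)_{n\in\omega}$ is a fixed $F$-basis of $E$. For $x\in E$, $\mathrm{supp}(x)$ is the (finite) set of $n\in\omega$ such that $e_n$ has nonzero coefficient in the expansion of $x$. For nonzero $x,y\in E$, write $x<y$ if $\max(\mathrm{supp}(x))<\min(\mathrm{supp}(y))$. A block sequence is a sequence $(x_n)$ of nonzero vectors with $x_n<x_{n+1}$ for all $n$; a block subspace is the linear span of an infinite block sequence. Two infinite-dimensional subspaces $X,Y$ of $E$ are almost disjoint if $X\cap Y$ is finite-dimensional. An almost disjoint family of block subspaces is a set of pairwise almost disjoint block subspaces; it is a mad family of block subspaces if it is not properly contained in another such family. Define $\mathfrak{a}_{\mathrm{vec},F}=\min\{|\mathcal{A}|:\mathcal{A}\text{ is an infinite mad family of block subspaces of }E\}$. $\mathrm{non}(\mathcal{M})$ is the minimum cardinality of a nonmeager subset of $\mathbb{R}$. *)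

theory Defs
  imports "HOL-Analysis.Analysis"
begin

unbundle cardinal_syntax

text \<open>
  The minimum cardinality of a member of a family of sets, as a cardinal in the sense of
  HOL's cardinals (a cardinal order on the element type). The choice among the members of least
  cardinality is irrelevant up to \<open>=o\<close>; the value is unspecified if the family is empty.
\<close>

definition min_card :: "'a set set \<Rightarrow> 'a rel" where
  "min_card K = card_of (SOME A. A \<in> K \<and> (\<forall>B\<in>K. |A| \<le>o |B| ))"

lemma min_card:
  assumes "K \<noteq> {}"
  shows "\<exists>A\<in>K. min_card K = |A|" and "\<And>B. B \<in> K \<Longrightarrow> min_card K \<le>o |B|"
proof -
  have "\<exists>r\<in>card_of ` K. \<forall>r'\<in>card_of ` K. r \<le>o r'"
    using assms by (intro exists_minim_Card_order) (auto simp: card_of_Card_order)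
  then have "\<exists>A. A \<in> K \<and> (\<forall>B\<in>K. |A| \<le>o |B| )"
    by auto
  from someI_ex[OF this]
  show "\<exists>A\<in>K. min_card K = |A|" and "\<And>B. B \<in> K \<Longrightarrow> min_card K \<le>o |B|"
    unfolding min_card_def by auto
qed

definition nowhere_dense :: "'a::topological_space set \<Rightarrow> bool" where
  "nowhere_dense S \<longleftrightarrow> interior (closure S) = {}"

definition meager :: "'a::topological_space set \<Rightarrow> bool" where
  "meager S \<longleftrightarrow> (\<exists>\<N>. countable \<N> \<and> (\<forall>N\<in>\<N>. nowhere_dense N) \<and> S \<subseteq> \<Union>\<N>)"

definition non_M :: "real rel" where
  "non_M = min_card {S :: real set. \<not> meager S}"

text \<open>
  A vector space of countably infinite dimension together with a fixed basis indexed by the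
  natural numbers.
\<close>

locale vector_space_nat_basis = vector_space scale
  for scale :: "'f::field \<Rightarrow> 'v::ab_group_add \<Rightarrow> 'v" +
  fixes e :: "nat \<Rightarrow> 'v"
  assumes inj_e: "inj e"
    and independent_e: "independent (range e)"
    and span_e: "span (range e) = UNIV"
begin

definition supp :: "'v \<Rightarrow> nat set" where
  "supp x = {n. representation (range e) x (e n) \<noteq> 0}"

text \<open>Only meaningful for nonzero vectors, whose supports are finite and nonempty.\<close>

definition vec_less :: "'v \<Rightarrow> 'v \<Rightarrow> bool" where
  "vec_less x y \<longleftrightarrow> Max (supp x) < Min (supp y)"

definition block_sequence :: "(nat \<Rightarrow> 'v) \<Rightarrow> bool" where
  "block_sequence x \<longleftrightarrow> (\<forall>n. x n \<noteq> 0) \<and> (\<forall>n. vec_less (x n) (x (Suc n)))"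

definition block_subspace :: "'v set \<Rightarrow> bool" where
  "block_subspace X \<longleftrightarrow> (\<exists>x. block_sequence x \<and> X = span (range x))"

definition finite_dim :: "'v set \<Rightarrow> bool" where
  "finite_dim X \<longleftrightarrow> (\<exists>B. finite B \<and> independent B \<and> span B = X)"

definition almost_disjoint :: "'v set \<Rightarrow> 'v set \<Rightarrow> bool" where
  "almost_disjoint X Y \<longleftrightarrow>
     subspace X \<and> \<not> finite_dim X \<and> subspace Y \<and> \<not> finite_dim Y \<and> finite_dim (X \<inter> Y)"

definition ad_family :: "'v set set \<Rightarrow> bool" where
  "ad_family \<A> \<longleftrightarrow> (\<forall>X\<in>\<A>. block_subspace X) \<and> pairwise almost_disjoint \<A>"

definition mad_family :: "'v set set \<Rightarrow> bool" where
  "mad_family \<A> \<longleftrightarrow> ad_family \<A> \<and> \<not> (\<exists>\<B>. ad_family \<B> \<and> \<A> \<subset> \<B>)"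

definition a_vec :: "'v set rel" where
  "a_vec = min_card {\<A>. infinite \<A> \<and> mad_family \<A>}"

end

end

theory Submission
  imports Defs
begin

text \<open>
  Let \<open>\<A>\<close> be an infinite mad family and let \<open>X0 \<noteq> X1\<close> be two of its members, spanned by block sequences
  \<open>a\<close> and \<open>b\<close>. Consider block sequences of vectors \<open>y n = a p + b q\<close>, where \<open>p\<close> is determined by
  the earlier vectors and \<open>q\<close> is free. A member \<open>X\<close> of \<open>\<A>\<close> can meet the span of \<open>y\<close> in an
  infinite-dimensional space only if \<open>y n \<in> X + span {y m | m < n}\<close> for infinitely many \<open>n\<close>. If
  \<open>X = X1\<close>, this fails because the \<open>X0\<close>-components are independent modulo \<open>X1\<close>. If \<open>X \<noteq> X1\<close> and
  \<open>d = dim (X \<inter> X1)\<close>, then at most \<open>d + n + 1 \<le> 2 * n + 1\<close> values of \<open>q\<close> are bad at a stage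
  \<open>n \<ge> d\<close>, as differences of bad vectors lie in \<open>X1 \<inter> (X + span {y m | m < n})\<close>. By maximality no
  choice of the numbers \<open>q\<close> avoids the bad values of every \<open>X\<close>, so the members of \<open>\<A>\<close>
  provide slaloms of prescribed widths that capture each \<open>g :: nat \<Rightarrow> nat\<close> infinitely often. As in
  Bartoszynski's characterization of \<open>non_M\<close>, such a family of slaloms yields a nonmeager set of
  the same cardinality.
\<close>

section \<open>Infinitely often equal families and nonmeager sets\<close>

text \<open>Let \<open>g n\<close> code the block of values of \<open>G\<close> at the points
  \<open>(n, j)\<close> with \<open>j < h n\<close>. The \<open>j\<close>-th member of
  \<open>B i n\<close> is used only to guess coordinate \<open>j\<close>; if the code is that
  member, the guess is right. The bound on \<open>card (B i n)\<close> provides a coordinate for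
  every member.\<close>

lemma slalom_imp_infinitely_often_equal:
  fixes B :: "'i \<Rightarrow> nat \<Rightarrow> nat set" and h :: "nat \<Rightarrow> nat"
  assumes B: "\<And>g. \<exists>i\<in>A. infinite {n. g n \<in> B i n \<and> finite (B i n) \<and> card (B i n) \<le> h n}"
  obtains F :: "'i \<Rightarrow> nat \<Rightarrow> nat" where "\<And>g. \<exists>i\<in>A. infinite {n. F i n = g n}"
proof
  define F where "F = (\<lambda>i k. case prod_decode k of (n, j) \<Rightarrow>
    (from_nat (sorted_list_of_set (B i n) ! j) :: nat list) ! j)"
  fix G :: "nat \<Rightarrow> nat"
  define t where "t n = map (\<lambda>j. G (prod_encode (n, j))) [0..<h n]" for n
  obtain i where i: "i \<in> A"
    and inf: "infinite {n. to_nat (t n) \<in> B i n \<and> finite (B i n) \<and> card (B i n) \<le> h n}"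
    (is "infinite ?N")
    using B[of "\<lambda>n. to_nat (t n)"] by blast
  have "\<exists>j. F i (prod_encode (n, j)) = G (prod_encode (n, j))" if "n \<in> ?N" for n
  proof -
    from that obtain j where j: "j < card (B i n)" "sorted_list_of_set (B i n) ! j = to_nat (t n)"
      by (metis (mono_tags, lifting) in_set_conv_nth length_sorted_list_of_set mem_Collect_eq
          set_sorted_list_of_set)
    with that have "j < h n" by auto
    with j have "F i (prod_encode (n, j)) = G (prod_encode (n, j))"
      by (simp add: F_def t_def)
    then show ?thesis ..
  qed
  then obtain j where j: "\<And>n. n \<in> ?N \<Longrightarrow> F i (prod_encode (n, j n)) = G (prod_encode (n, j n))"
    by metis
  have "inj_on (\<lambda>n. prod_encode (n, j n)) ?N"
    by (auto intro: inj_onI simp: prod_encode_eq)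
  with inf have "infinite ((\<lambda>n. prod_encode (n, j n)) ` ?N)"
    using finite_imageD by blast
  moreover have "(\<lambda>n. prod_encode (n, j n)) ` ?N \<subseteq> {n. F i n = G n}"
    using j by blast
  ultimately show "\<exists>i\<in>A. infinite {n. F i n = G n}"
    using i infinite_super by blast
qed

text \<open>
  Guess, for each \<open>n\<close>, the restriction of \<open>g\<close> to the first \<open>n + 1\<close> elements of \<open>X\<close>: a correct
  guess always contains a point not used at the \<open>n\<close> earlier stages.
\<close>

lemma infinitely_often_equal_on_infinite_sets:
  fixes F :: "'i \<Rightarrow> nat \<Rightarrow> nat"
  assumes F: "\<And>g. \<exists>i\<in>A. infinite {n. F i n = g n}"
  obtains F' :: "'i \<Rightarrow> nat \<Rightarrow> nat"
    where "\<And>g X. infinite X \<Longrightarrow> \<exists>i\<in>A. infinite {n \<in> X. F' i n = g n}"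
proof -
  define L where "L i n = (from_nat (F i n) :: (nat \<times> nat) list)" for i n
  define P where "P i c n r \<longleftrightarrow> (n < card (fst ` set (L i n)) \<longrightarrow>
      r \<in> set (L i n) \<and> fst r \<notin> (fst \<circ> c) ` {..<n})" for i n r and c :: "nat \<Rightarrow> nat \<times> nat"
  have "\<exists>c. \<forall>n. P i c n (c n)" for i
  proof (rule dependent_wellorder_choice)
    fix n :: nat and c :: "nat \<Rightarrow> nat \<times> nat"
    have "\<not> fst ` set (L i n) \<subseteq> (fst \<circ> c) ` {..<n}" if "n < card (fst ` set (L i n))"
    proof
      assume "fst ` set (L i n) \<subseteq> (fst \<circ> c) ` {..<n}"
      then have "card (fst ` set (L i n)) \<le> card {..<n}"
        by (meson card_image_le card_mono finite_imageI finite_lessThan le_trans)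
      with that show False by simp
    qed
    then show "\<exists>r. P i c n r"
      unfolding P_def by blast
  next
    fix r and f g :: "nat \<Rightarrow> nat \<times> nat" and n :: nat
    assume "\<And>m. m < n \<Longrightarrow> f m = g m"
    then have "(fst \<circ> f) ` {..<n} = (fst \<circ> g) ` {..<n}"
      by (intro image_cong) auto
    then show "P i f n r = P i g n r"
      by (simp add: P_def)
  qed
  then obtain c where c: "\<And>i n. P i (c i) n (c i n)"
    by metis
  define F' where "F' i x = snd (c i (LEAST n. fst (c i n) = x))" for i x
  show ?thesis
  proof
    fix g :: "nat \<Rightarrow> nat" and X :: "nat set"
    assume X: "infinite X"
    define l where "l n = map (\<lambda>k. (enumerate X k, g (enumerate X k))) [0..<Suc n]" for n
    obtain i where i: "i \<in> A" and inf: "infinite {n. F i n = to_nat (l n)}" (is "infinite ?N")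
      using F[of "\<lambda>n. to_nat (l n)"] by blast
    have L: "L i n = l n" if "n \<in> ?N" for n
      using that by (simp add: L_def)
    have "fst ` set (l n) = enumerate X ` {..<Suc n}" for n
      by (simp add: l_def image_image atLeast0LessThan del: upt_Suc)
    then have "card (fst ` set (l n)) = Suc n" for n
      using X by (metis card_image card_lessThan inj_enumerate inj_on_subset subset_UNIV)
    with c L have c_l: "c i n \<in> set (l n)" and fresh: "fst (c i n) \<notin> (fst \<circ> c i) ` {..<n}"
      if "n \<in> ?N" for n
      using that c[of i n] by (simp_all add: P_def)
    \<comment> \<open>Freshness makes \<open>n\<close> the first stage at which its point occurs, so
      \<open>F'\<close> reads off the entry picked there.\<close>
    have "(LEAST m. fst (c i m) = fst (c i n)) = n" if "n \<in> ?N" for n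
      using fresh[OF that] by (intro Least_equality refl) (metis comp_apply image_eqI lessThan_iff not_le)
    then have F'_c: "F' i (fst (c i n)) = snd (c i n)" if "n \<in> ?N" for n
      using that by (simp add: F'_def)
    have "inj_on (\<lambda>n. fst (c i n)) ?N"
      using fresh by (intro linorder_inj_onI') (metis comp_apply image_eqI lessThan_iff)
    with inf have "infinite ((\<lambda>n. fst (c i n)) ` ?N)"
      using finite_imageD by blast
    moreover have "(\<lambda>n. fst (c i n)) ` ?N \<subseteq> {x \<in> X. F' i x = g x}"
    proof safe
      fix n assume "F i n = to_nat (l n)"
      then have n: "n \<in> ?N" by simp
      then obtain k where "c i n = (enumerate X k, g (enumerate X k))"
        using c_l by (fastforce simp: l_def)
      then show "fst (c i n) \<in> X" "F' i (fst (c i n)) = g (fst (c i n))"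
        using X F'_c[OF n] by (auto simp: enumerate_in_set)
    qed
    ultimately show "\<exists>i\<in>A. infinite {n \<in> X. F' i n = g n}"
      using i infinite_super by blast
  qed
qed

section \<open>Closed intervals, meager sets and growth rates\<close>

lemma countable_compact_pi_base_real:
  obtains K :: "nat \<Rightarrow> real set"
  where "\<And>p. compact (K p)" "\<And>p. interior (K p) \<noteq> {}"
    "\<And>U. open U \<Longrightarrow> U \<noteq> {} \<Longrightarrow> \<exists>p. K p \<subseteq> U"
proof
  \<comment> \<open>Pairs with \<open>a \<ge> b\<close> code the unit interval, so that every
    \<open>K p\<close> has nonempty interior.\<close>
  define K :: "nat \<Rightarrow> real set" where
    "K p = (case from_nat p :: rat \<times> rat of (a, b) \<Rightarrow>
       if a < b then {of_rat a..of_rat b} else {0..1})" for p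
  show "compact (K p)" for p
    by (simp add: K_def split: prod.split)
  show "interior (K p) \<noteq> {}" for p
    by (simp add: K_def of_rat_less not_le split: prod.split)
  fix U :: "real set"
  assume U: "open U" "U \<noteq> {}"
  then obtain x where "x \<in> U" by blast
  with U obtain d where d: "d > 0" "ball x d \<subseteq> U"
    by (meson open_contains_ball)
  obtain a b :: rat where ab: "x < of_rat a" "of_rat a < (of_rat b :: real)" "of_rat b < x + d"
    using of_rat_dense[of x "x + d"] d(1) by (metis less_add_same_cancel1 of_rat_dense)
  then have "K (to_nat (a, b)) \<subseteq> ball x d"
    by (auto simp: K_def of_rat_less dist_real_def)
  with d show "\<exists>p. K p \<subseteq> U" by blast
qed

lemma meager_increasing_cover:
  assumes "meager S"
  shows "\<exists>M :: nat \<Rightarrow> 'a::topological_space set.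
    (\<forall>n. closed (M n)) \<and> (\<forall>n. interior (M n) = {}) \<and> mono M \<and> S \<subseteq> (\<Union>n. M n)"
proof -
  obtain \<N> :: "'a set set" where N: "countable \<N>" "\<And>N. N \<in> \<N> \<Longrightarrow> nowhere_dense N" "S \<subseteq> \<Union>\<N>"
    using assms unfolding meager_def by blast
  define T where "T = from_nat_into (insert {} \<N>)"
  define M where "M n = (\<Union>k\<le>n. closure (T k))" for n
  have T: "range T = insert {} \<N>"
    unfolding T_def using N(1) by (intro range_from_nat_into) auto
  have nd: "interior (closure (T k)) = {}" for k
    using T N(2) by (metis closure_empty insert_iff interior_empty nowhere_dense_def rangeI)
  show ?thesis
  proof (intro exI conjI allI)
    show closed: "closed (M n)" for n
      unfolding M_def by auto
    show "interior (M n) = {}" for n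
    proof (induction n)
      case (Suc n)
      have "M (Suc n) = M n \<union> closure (T (Suc n))"
        by (auto simp: M_def atMost_Suc)
      then show ?case
        using Suc nd closed interior_closed_Un_empty_interior by metis
    qed (simp add: M_def nd)
    show "mono M"
      unfolding M_def by (intro monoI UN_mono) auto
    have "\<Union>\<N> \<subseteq> (\<Union>k. T k)"
      using T by auto
    also have "\<dots> \<subseteq> (\<Union>n. M n)"
      using closure_subset unfolding M_def by blast
    finally show "S \<subseteq> (\<Union>n. M n)"
      by (rule order_trans[OF N(3)])
  qed
qed

text \<open>If \<open>j (Suc n) < h (j n)\<close> from \<open>n0\<close> on, iteration bounds
  \<open>j n\<close> by \<open>(h ^^ (n - n0)) (j n0)\<close>, hence by \<open>(h ^^ n) n\<close>
  once \<open>n \<ge> max n0 (j n0)\<close>.\<close>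

lemma infinitely_often_large_jumps:
  fixes j h :: "nat \<Rightarrow> nat"
  assumes h: "mono h" "\<And>n. n \<le> h n" and inf: "infinite {n. (h ^^ n) n < j n}"
  shows "infinite {n. h (j n) \<le> j (Suc n)}"
proof
  assume "finite {n. h (j n) \<le> j (Suc n)}"
  then obtain n0 where n0: "\<And>n. n0 \<le> n \<Longrightarrow> j (Suc n) < h (j n)"
    unfolding finite_nat_set_iff_bounded by (metis linorder_not_le mem_Collect_eq)
  have bound: "j (n0 + k) \<le> (h ^^ k) (j n0)" for k
  proof (induction k)
    case (Suc k)
    have "j (n0 + Suc k) \<le> h (j (n0 + k))"
      using n0[of "n0 + k"] by simp
    also have "\<dots> \<le> h ((h ^^ k) (j n0))"
      using Suc h(1) by (simp add: monoD)
    finally show ?case by simp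
  qed simp
  have mono: "mono (h ^^ k)" for k
    using h(1) by (rule mono_pow)
  have incr: "x \<le> (h ^^ k) x" for x k
    by (induction k) (use h(2) in \<open>auto intro: le_trans\<close>)
  have "j n \<le> (h ^^ n) n" if "max n0 (j n0) \<le> n" for n
  proof -
    have "j n \<le> (h ^^ (n - n0)) (j n0)"
      using bound[of "n - n0"] that by simp
    also have "\<dots> \<le> (h ^^ (n - n0)) ((h ^^ n0) (j n0))"
      by (intro monoD[OF mono] incr)
    also have "\<dots> = (h ^^ n) (j n0)"
      using that by (simp flip: funpow_add comp_apply[of "h ^^ (n - n0)" "h ^^ n0"])
    also have "\<dots> \<le> (h ^^ n) n"
      using that by (intro monoD[OF mono]) simp
    finally show ?thesis .
  qed
  then have "{n. (h ^^ n) n < j n} \<subseteq> {..<max n0 (j n0)}"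
    by (force simp: not_less[symmetric])
  with inf show False
    using finite_subset by blast
qed

text \<open>
  A pair \<open>(i, i')\<close> of indices yields a decreasing sequence of compact sets \<open>K (p n)\<close>: the guesses of
  \<open>i\<close> provide bounds \<open>j n\<close> on the indices \<open>p n\<close>, and the guess of \<open>i'\<close> at stage \<open>n\<close> is a finite table
  that tells, for each possible value of \<open>p n\<close>, how to continue. If infinitely often the bounds
  leave enough room and the table is correct, then the limit point escapes a given meager set.
\<close>

theorem infinitely_often_equal_imp_nonmeager:
  fixes F :: "'i \<Rightarrow> nat \<Rightarrow> nat"
  assumes A: "infinite A" and F: "\<And>g. \<exists>i\<in>A. infinite {n. F i n = g n}"
  obtains S :: "real set" where "\<not> meager S" "|S| \<le>o |A|"
proof -
  obtain K :: "nat \<Rightarrow> real set" where K: "\<And>p. compact (K p)" "\<And>p. interior (K p) \<noteq> {}"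
    "\<And>U. open U \<Longrightarrow> U \<noteq> {} \<Longrightarrow> \<exists>p. K p \<subseteq> U"
    using countable_compact_pi_base_real by blast
  obtain F' :: "'i \<Rightarrow> nat \<Rightarrow> nat"
    where F': "\<And>g X. infinite X \<Longrightarrow> \<exists>i\<in>A. infinite {n \<in> X. F' i n = g n}"
    using infinitely_often_equal_on_infinite_sets[OF F] by blast
  \<comment> \<open>Partial sums make \<open>j i\<close> strictly increasing and larger than
    \<open>F i\<close>.\<close>
  define j where "j i n = (\<Sum>k\<le>n. Suc (F i k))" for i n
  \<comment> \<open>A useless guess leaves \<open>p\<close> unchanged, so the sets stay nested and
    \<open>p i i' n \<le> j i n\<close> always holds.\<close>
  define step where "step i i' n p =
      (let q = (from_nat (F' i' n) :: nat list) ! p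
       in if q \<le> j i (Suc n) \<and> K q \<subseteq> K p then q else p)" for i i' n p
  define p where "p i i' = rec_nat 0 (step i i')" for i i'
  have p0: "p i i' 0 = 0" and pSuc: "p i i' (Suc n) = step i i' n (p i i' n)" for i i' n
    by (simp_all add: p_def)
  have j_Suc: "j i n < j i (Suc n)" and j_gt: "F i n < j i n" for i n
    by (simp add: j_def, induction n) (simp_all add: j_def)
  have j_ge: "n \<le> j i n" for i n
    by (induction n) (use j_Suc in \<open>auto intro: Suc_leI le_less_trans\<close>)
  have p_le: "p i i' n \<le> j i n" for i i' n
  proof (induction n)
    case (Suc n)
    then show ?case
      using j_Suc[of i n] by (simp add: pSuc step_def Let_def)
  qed (simp add: p0)
  have "K (p i i' (Suc n)) \<subseteq> K (p i i' n)" for i i' n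
    by (simp add: pSuc step_def Let_def)
  then have anti: "K (p i i' n) \<subseteq> K (p i i' m)" if "m \<le> n" for i i' m n
    using lift_Suc_antimono_le[of "\<lambda>n. K (p i i' n)"] that by blast
  have "(\<Inter>n. K (p i i' n)) \<noteq> {}" for i i'
  proof (rule compact_nest)
    show "K (p i i' n) \<noteq> {}" for n
      using K(2) interior_empty by metis
  qed (use K(1) anti in auto)
  then have "\<exists>x. \<forall>n. x \<in> K (p i i' n)" for i i'
    by (simp add: set_eq_iff)
  then obtain x where x: "\<And>i i' n. x i i' \<in> K (p i i' n)"
    by metis
  define S where "S = (\<lambda>(i, i'). x i i') ` (A \<times> A)"
  have "|S| \<le>o |A|"
    unfolding S_def using card_of_image card_of_Times_same_infinite[OF A] by (rule ordLeq_ordIso_trans)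
  moreover have "\<not> meager S"
  proof
    assume "meager S"
    from meager_increasing_cover[OF this] obtain M :: "nat \<Rightarrow> real set"
      where M: "\<forall>n. closed (M n)" "\<forall>n. interior (M n) = {}" "mono M" "S \<subseteq> (\<Union>n. M n)"
      by (elim exE conjE)
    have avoid: "\<exists>q. K q \<subseteq> K r \<and> K q \<inter> M m = {}" for r m
    proof -
      have "\<not> interior (K r) \<subseteq> M m"
        using K(2)[of r] M(2) by (metis interior_maximal open_interior subset_empty)
      then have "\<exists>q. K q \<subseteq> interior (K r) - M m"
        using M(1) by (intro K(3)) (auto simp: open_Diff)
      then show ?thesis
        using interior_subset by blast
    qed
    then obtain Q where Q: "\<And>r m. K (Q r m) \<subseteq> K r" "\<And>r m. K (Q r m) \<inter> M m = {}"
      by metis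
    \<comment> \<open>\<open>h m\<close> bounds all \<open>Q r k\<close> with
      \<open>r \<le> k \<le> m\<close>; summing over \<open>k\<close> makes \<open>h\<close>
      monotone, and the summand \<open>m\<close> gives \<open>m \<le> h m\<close>.\<close>
    define h where "h m = m + (\<Sum>k\<le>m. \<Sum>r\<le>k. Q r k)" for m
    have "mono h"
      unfolding h_def by (intro monoI add_mono sum_mono2) auto
    have h_ge: "m \<le> h m" for m
      by (simp add: h_def)
    have Q_le: "Q r m \<le> h m" if "r \<le> m" for r m
    proof -
      have "Q r m \<le> (\<Sum>r\<le>m. Q r m)"
        using that by (intro member_le_sum) auto
      also have "\<dots> \<le> (\<Sum>k\<le>m. \<Sum>r\<le>k. Q r k)"
        by (intro member_le_sum[of m "{..m}" "\<lambda>k. \<Sum>r\<le>k. Q r k"]) auto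
      finally show ?thesis by (simp add: h_def)
    qed
    obtain i where i: "i \<in> A" and inf: "infinite {n. F i n = (h ^^ n) n}"
      using F[of "\<lambda>n. (h ^^ n) n"] by (rule bexE)
    define X where "X = {n. h (j i n) \<le> j i (Suc n)}"
    have "{n. F i n = (h ^^ n) n} \<subseteq> {n. (h ^^ n) n < j i n}"
      using j_gt by (metis (mono_tags, lifting) Collect_mono)
    with inf have "infinite {n. (h ^^ n) n < j i n}"
      using infinite_super by blast
    then have "infinite X"
      unfolding X_def using \<open>mono h\<close> h_ge by (intro infinitely_often_large_jumps)
    \<comment> \<open>The value \<open>p i i' n\<close> depends on \<open>i'\<close>, which is not
      yet chosen; a table covering all \<open>r \<le> j i n\<close> can be fixed once
      \<open>i\<close> is known.\<close>
    from F'[OF this] obtain i' where i': "i' \<in> A" and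
      inf': "infinite {n \<in> X. F' i' n = to_nat (map (\<lambda>r. Q r (j i n)) [0..<Suc (j i n)])}"
      by (rule bexE)
    have "x i i' \<in> S"
      using i i' by (auto simp: S_def)
    with M(4) obtain m where m: "x i i' \<in> M m" by blast
    \<comment> \<open>The limit point avoids \<open>M (j i n)\<close> at a correct stage, and
      \<open>m \<le> n \<le> j i n\<close> makes this set contain \<open>M m\<close>.\<close>
    from inf' obtain n where n: "m \<le> n" "n \<in> X"
      and F'n: "F' i' n = to_nat (map (\<lambda>r. Q r (j i n)) [0..<Suc (j i n)])"
      unfolding infinite_nat_iff_unbounded_le by blast
    let ?r = "p i i' n"
    have "Q ?r (j i n) \<le> j i (Suc n)"
      using Q_le[OF p_le[of i i' n]] n(2) by (simp add: X_def)
    moreover have "map (\<lambda>r. Q r (j i n)) [0..<Suc (j i n)] ! ?r = Q ?r (j i n)"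
      using p_le[of i i' n] by (simp del: upt_Suc)
    ultimately have "p i i' (Suc n) = Q ?r (j i n)"
      using Q(1) by (simp add: pSuc step_def F'n Let_def del: upt_Suc)
    then have "x i i' \<notin> M (j i n)"
      using x[of i i' "Suc n"] Q(2) by (metis IntI emptyE)
    moreover have "M m \<subseteq> M (j i n)"
      using M(3) n(1) j_ge[of n i] by (meson le_trans monoD)
    ultimately show False
      using m by blast
  qed
  ultimately show ?thesis
    using that by blast
qed

section \<open>Spans and dimension bounds\<close>

context vector_space
begin

text \<open>A linear dependence uses finitely many vectors, hence lies in an initial segment, and
  initial segments are independent by induction.\<close>

lemma strictly_increasing_spans_imp_independent:
  fixes y :: "nat \<Rightarrow> 'b"
  assumes y: "\<And>n. y n \<notin> span (y ` {..<n})"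
  shows "inj y" "independent (range y)"
proof -
  show "inj y"
    using y by (intro linorder_injI) (metis imageI lessThan_iff span_base)
  have ind: "independent (y ` {..<n})" for n
    by (induction n) (use y in \<open>auto simp: lessThan_Suc independent_insertI independent_empty\<close>)
  show "independent (range y)"
  proof
    assume "dependent (range y)"
    then obtain T where T: "T \<subseteq> range y" "finite T" "dependent T"
      unfolding dependent_explicit[of "range y"]
      by (metis (mono_tags, lifting) dependent_finite)
    then obtain N where "finite N" "T = y ` N"
      using finite_subset_image by metis
    moreover from this obtain n where "N \<subseteq> {..<n}"
      using finite_nat_bounded by blast
    ultimately show False
      using T ind dependent_mono by (metis image_mono)
  qed
qed

lemma span_range_eq_Union:
  fixes y :: "nat \<Rightarrow> 'b"
  shows "span (range y) = (\<Union>n. span (y ` {..<n}))"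
proof (intro antisym subsetI)
  fix v assume "v \<in> span (range y)"
  then obtain T r where "finite T" "T \<subseteq> range y" "v = (\<Sum>a\<in>T. scale (r a) a)"
    by (auto simp: span_explicit)
  then have T: "finite T" "T \<subseteq> range y" "v \<in> span T"
    by (auto intro: span_sum span_scale span_base)
  then obtain N where "finite N" "T = y ` N"
    using finite_subset_image by metis
  moreover from this obtain n where "N \<subseteq> {..<n}"
    using finite_nat_bounded by blast
  ultimately show "v \<in> (\<Union>n. span (y ` {..<n}))"
    using T(3) by (meson UN_I UNIV_I image_mono span_mono subsetD)
next
  fix v assume "v \<in> (\<Union>n. span (y ` {..<n}))"
  then show "v \<in> span (range y)"
    by (meson UN_E image_mono span_mono subsetD subset_UNIV)
qed

text \<open>Each new vector \<open>t\<close> costs at most one generator: a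
  \<open>w0 \<in> W\<close> that really involves \<open>t\<close> can be used to clear the
  \<open>t\<close>-coefficient of every other vector of the intersection.\<close>

lemma Int_span_Un_finite_subset_span:
  assumes W: "subspace W" and T: "finite T" and B: "finite B" "W \<inter> span Z \<subseteq> span B"
  shows "\<exists>B'. finite B' \<and> card B' \<le> card B + card T \<and> W \<inter> span (Z \<union> T) \<subseteq> span B'"
  using T
proof (induction T)
  case empty
  then show ?case using B by auto
next
  case (insert t T)
  then obtain B' where B': "finite B'" "card B' \<le> card B + card T" "W \<inter> span (Z \<union> T) \<subseteq> span B'"
    by blast
  show ?case
  proof (cases "W \<inter> span (Z \<union> insert t T) \<subseteq> span (Z \<union> T)")
    case True
    then show ?thesis
      using B' insert by (intro exI[of _ B']) auto
  next
    case False
    then obtain w0 where w0: "w0 \<in> W" "w0 \<in> span (insert t (Z \<union> T))" "w0 \<notin> span (Z \<union> T)"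
      by auto
    then obtain c where c: "w0 - scale c t \<in> span (Z \<union> T)"
      by (auto simp: span_insert)
    with w0(3) have "c \<noteq> 0" by auto
    have "W \<inter> span (insert t (Z \<union> T)) \<subseteq> span (insert w0 B')"
    proof
      fix w assume w: "w \<in> W \<inter> span (insert t (Z \<union> T))"
      then obtain d where d: "w - scale d t \<in> span (Z \<union> T)"
        by (auto simp: span_insert)
      have "w - scale (d / c) w0 = (w - scale d t) - scale (d / c) (w0 - scale c t)"
        using \<open>c \<noteq> 0\<close> by (simp add: scale_right_diff_distrib)
      then have "w - scale (d / c) w0 \<in> span (Z \<union> T)"
        using c d by (metis span_diff span_scale)
      moreover have "w - scale (d / c) w0 \<in> W"
        using W w w0(1) by (simp add: subspace_diff subspace_scale)
      ultimately have "w - scale (d / c) w0 \<in> span B'"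
        using B'(3) by blast
      then show "w \<in> span (insert w0 B')"
        by (auto simp: span_insert)
    qed
    then show ?thesis
      using B'(1,2) insert.hyps
      by (intro exI[of _ "insert w0 B'"]) (auto simp: card_insert_if)
  qed
qed

lemma Int_span_range_subset_span:
  fixes y :: "nat \<Rightarrow> 'b"
  assumes X: "subspace X" and y: "\<And>n. N \<le> n \<Longrightarrow> y n \<notin> span (X \<union> y ` {..<n})"
  shows "X \<inter> span (range y) \<subseteq> span (y ` {..<N})"
proof -
  have "X \<inter> span (y ` {..<n}) \<subseteq> span (y ` {..<N})" for n
  proof (induction n)
    case (Suc n)
    show ?case
    proof (cases "N \<le> n")
      case False
      then show ?thesis
        by (meson Suc_leI image_mono inf.coboundedI2 lessThan_subset_iff not_le span_mono)
    next
      case True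
      have "v \<in> span (y ` {..<n})" if v: "v \<in> X" "v \<in> span (y ` {..<Suc n})" for v
      proof -
        obtain c where c: "v - scale c (y n) \<in> span (y ` {..<n})"
          using v(2) by (auto simp: lessThan_Suc span_insert)
        have "c = 0"
        proof (rule ccontr)
          assume "c \<noteq> 0"
          have "v - (v - scale c (y n)) \<in> span (X \<union> y ` {..<n})"
          proof (rule span_diff)
            show "v - scale c (y n) \<in> span (X \<union> y ` {..<n})"
              using c span_mono[of "y ` {..<n}"] by blast
          qed (use v(1) in \<open>auto intro: span_base\<close>)
          then have "scale c (y n) \<in> span (X \<union> y ` {..<n})"
            by simp
          then have "scale (inverse c) (scale c (y n)) \<in> span (X \<union> y ` {..<n})"
            by (rule span_scale)
          moreover have "scale (inverse c) (scale c (y n)) = y n"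
            using \<open>c \<noteq> 0\<close> by simp
          ultimately show False
            using y[OF True] by simp
        qed
        with c show ?thesis by simp
      qed
      with Suc show ?thesis by blast
    qed
  qed (auto intro: span_mono[THEN subsetD])
  then show ?thesis
    unfolding span_range_eq_Union by blast
qed

text \<open>For a fixed solution \<open>r\<close>, every difference \<open>b q - b r\<close> lies in
  \<open>W \<inter> span Z\<close>. Thus the independent vectors \<open>b q\<close> all lie in
  \<open>span (insert (b r) B)\<close>.\<close>

lemma card_affine_translates_in_span_le:
  assumes b: "inj b" "independent (range b)" and W: "subspace W" "range b \<subseteq> W"
    and Z: "W \<inter> span Z \<subseteq> span B" "finite B"
  shows "finite {q. a + b q \<in> span Z} \<and> card {q. a + b q \<in> span Z} \<le> Suc (card B)"
proof (cases "{q. a + b q \<in> span Z} = {}")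
  case False
  then obtain r where r: "a + b r \<in> span Z" by blast
  let ?Q = "{q. a + b q \<in> span Z}"
  have "b ` ?Q \<subseteq> span (insert (b r) B)"
  proof
    fix v assume "v \<in> b ` ?Q"
    then obtain q where q: "v = b q" "a + b q \<in> span Z" by blast
    have "b q - b r = (a + b q) - (a + b r)" by simp
    then have "b q - b r \<in> span Z"
      using q r by (metis span_diff)
    moreover have "b q - b r \<in> W"
      using W by (auto intro: subspace_diff)
    ultimately have "b q - scale 1 (b r) \<in> span B"
      using Z by auto
    then show "v \<in> span (insert (b r) B)"
      unfolding span_insert q by blast
  qed
  moreover have "independent (b ` ?Q)"
    using b(2) by (rule independent_mono) auto
  ultimately have "finite (b ` ?Q) \<and> card (b ` ?Q) \<le> card (insert (b r) B)"
    using Z(2) by (intro independent_span_bound) auto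
  moreover have "inj_on b ?Q"
    using b(1) inj_on_subset by blast
  moreover have "card (insert (b r) B) \<le> Suc (card B)"
    by (rule card_insert_le_m1) auto
  ultimately show ?thesis
    by (metis (no_types, lifting) card_image finite_imageD le_trans)
qed auto

end

section \<open>Block subspaces\<close>

context vector_space_nat_basis
begin

section \<open>Supports with respect to the fixed basis\<close>

lemma in_span_basis: "x \<in> span (range e)"
  by (simp add: span_e)

lemma supp_zero [simp]: "supp 0 = {}"
  by (simp add: supp_def representation_zero)

lemma supp_add: "supp (x + y) \<subseteq> supp x \<union> supp y"
  by (auto simp: supp_def representation_add independent_e in_span_basis)

lemma supp_scale: "supp (scale c x) \<subseteq> supp x"
  by (auto simp: supp_def representation_scale independent_e in_span_basis)

lemma supp_e [simp]: "supp (e n) = {n}"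
  using inj_e by (auto simp: supp_def representation_basis independent_e inj_eq)

lemma finite_supp [simp]: "finite (supp x)"
proof -
  have "finite (e ` supp x)"
    using finite_representation[of "range e" x] by (rule rev_finite_subset) (auto simp: supp_def)
  then show ?thesis
    using inj_e finite_imageD inj_on_subset by blast
qed

lemma supp_eq_empty_iff [simp]: "supp x = {} \<longleftrightarrow> x = 0"
proof
  assume *: "supp x = {}"
  have "representation (range e) x b = 0" for b
    using * representation_ne_zero[of "range e" x b] by (auto simp: supp_def)
  then have "(\<Sum>b | representation (range e) x b \<noteq> 0. scale (representation (range e) x b) b) = 0"
    by simp
  then show "x = 0"
    by (simp add: sum_nonzero_representation_eq independent_e in_span_basis)
qed auto

lemma subspace_supp_subset: "subspace {x. supp x \<subseteq> I}"
  using supp_add supp_scale by (intro subspaceI) (auto, (meson UnE subsetD)+)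

lemma supp_span_subset:
  assumes "\<And>v. v \<in> S \<Longrightarrow> supp v \<subseteq> I" "x \<in> span S"
  shows "supp x \<subseteq> I"
  using span_minimal[OF _ subspace_supp_subset[of I], of S] assms by blast

section \<open>Position and independence of block sequences\<close>

lemma block_sequence_Max_less_Min:
  assumes x: "block_sequence x" and "m < n"
  shows "Max (supp (x m)) < Min (supp (x n))"
  using \<open>m < n\<close>
proof (induction rule: less_Suc_induct)
  case (1 i)
  with x show ?case by (simp add: block_sequence_def vec_less_def)
next
  case (2 i j k)
  have "Min (supp (x j)) \<le> Max (supp (x j))"
    using x by (simp add: block_sequence_def)
  with 2 show ?case by linarith
qed

lemma block_sequence_supp_ge:
  assumes x: "block_sequence x"
  shows "supp (x n) \<subseteq> {n..}"
proof -
  have "n \<le> Min (supp (x n))"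
  proof (induction n)
    case (Suc n)
    have "Min (supp (x n)) \<le> Max (supp (x n))"
      using x by (simp add: block_sequence_def)
    with Suc block_sequence_Max_less_Min[OF x, of n "Suc n"] show ?case by simp
  qed simp
  then show ?thesis
    using Min_le[OF finite_supp] by (meson atLeast_iff le_trans subsetI)
qed

lemma block_sequence_notin_span:
  assumes x: "block_sequence x"
  shows "x n \<notin> span (x ` {..<n})"
proof
  assume "x n \<in> span (x ` {..<n})"
  moreover have "supp v \<subseteq> {..<Min (supp (x n))}" if "v \<in> x ` {..<n}" for v
  proof -
    from that obtain m where m: "m < n" "v = x m" by blast
    then show ?thesis
      using block_sequence_Max_less_Min[OF x m(1)] Max_ge[OF finite_supp] le_less_trans
      by (metis lessThan_iff subsetI)
  qed
  ultimately have "supp (x n) \<subseteq> {..<Min (supp (x n))}"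
    using supp_span_subset by blast
  moreover have "Min (supp (x n)) \<in> supp (x n)"
    using x by (intro Min_in) (auto simp: block_sequence_def)
  ultimately show False by blast
qed

lemma block_sequence_inj: "block_sequence x \<Longrightarrow> inj x"
  and block_sequence_independent: "block_sequence x \<Longrightarrow> independent (range x)"
  using strictly_increasing_spans_imp_independent[of x] block_sequence_notin_span by blast+

section \<open>Finite dimension and almost disjointness\<close>

lemma finite_dim_iff:
  assumes "subspace X"
  shows "finite_dim X \<longleftrightarrow> (\<exists>B. finite B \<and> X \<subseteq> span B)"
proof
  assume "\<exists>B. finite B \<and> X \<subseteq> span B"
  then obtain B where B: "finite B" "X \<subseteq> span B" by blast
  obtain C where C: "C \<subseteq> X" "independent C" "X \<subseteq> span C"
    using maximal_independent_subset by blast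
  then have "span C = X"
    using assms span_subspace by blast
  moreover have "finite C"
    using B C independent_span_bound by blast
  ultimately show "finite_dim X"
    using C(2) unfolding finite_dim_def by blast
qed (auto simp: finite_dim_def)

lemma block_subspace_infinite_dim:
  assumes "block_subspace X"
  shows "\<not> finite_dim X"
proof
  assume fin: "finite_dim X"
  obtain x where x: "block_sequence x" "X = span (range x)"
    using assms block_subspace_def by blast
  from fin obtain B where "finite B" "X = span B"
    by (auto simp: finite_dim_def)
  with x have "finite (range x)"
    using independent_span_bound[of B "range x"] block_sequence_independent span_superset by auto
  then show False
    using block_sequence_inj[OF x(1)] finite_imageD by blast
qed

lemma block_subspace_subspace: "block_subspace X \<Longrightarrow> subspace X"
  by (auto simp: block_subspace_def)

lemma almost_disjoint_block_iff:
  assumes "block_subspace X" "block_subspace Y"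
  shows "almost_disjoint X Y \<longleftrightarrow> finite_dim (X \<inter> Y)"
  using assms by (simp add: almost_disjoint_def block_subspace_infinite_dim block_subspace_subspace)

section \<open>Infinite mad families and their slaloms\<close>

lemma infinite_mad_family_exists: "\<exists>\<A>. infinite \<A> \<and> mad_family \<A>"
proof -
  \<comment> \<open>For fixed \<open>n\<close> the pairing function increases in \<open>m\<close>,
    and its values for different \<open>n\<close> are disjoint, so the \<open>X n\<close> are block
    subspaces with trivial intersections.\<close>
  define x where "x n m = e (prod_encode (n, m))" for n m
  define X where "X n = span (range (x n))" for n
  have "block_sequence (x n)" for n
    unfolding block_sequence_def vec_less_def
    using independent_e by (auto simp: x_def prod_encode_def dependent_zero)
  then have X: "block_subspace (X n)" for n
    by (auto simp: X_def block_subspace_def)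
  have supp_X: "supp v \<subseteq> {k. fst (prod_decode k) = n}" if "v \<in> X n" for v n
    using that unfolding X_def by (rule supp_span_subset[rotated]) (auto simp: x_def)
  have "X m \<inter> X n = {0}" if "m \<noteq> n" for m n
  proof -
    have "v = 0" if v: "v \<in> X m" "v \<in> X n" for v
    proof -
      have "supp v \<subseteq> {k. fst (prod_decode k) = m}" "supp v \<subseteq> {k. fst (prod_decode k) = n}"
        using v supp_X by blast+
      with \<open>m \<noteq> n\<close> have "supp v = {}" by blast
      then show ?thesis by simp
    qed
    then show ?thesis
      by (auto simp: X_def span_zero)
  qed
  moreover have "finite_dim {0}"
    unfolding finite_dim_def using independent_empty span_empty by blast
  ultimately have disj: "finite_dim (X m \<inter> X n)" if "m \<noteq> n" for m n
    using that by simp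
  have "inj X"
    using X block_subspace_infinite_dim disj by (metis inf.idem injI)
  \<comment> \<open>A family that is maximal among those containing \<open>range X\<close> is mad,
    since every larger family contains \<open>range X\<close> as well.\<close>
  let ?P = "{\<A>. ad_family \<A> \<and> range X \<subseteq> \<A>}"
  have "\<exists>M\<in>?P. \<forall>\<A>\<in>?P. M \<subseteq> \<A> \<longrightarrow> \<A> = M"
  proof (rule subset_Zorn_nonempty)
    have "ad_family (range X)"
      using X disj unfolding ad_family_def pairwise_def
      by (metis almost_disjoint_block_iff rangeE)
    then show "?P \<noteq> {}" by blast
    show "\<Union>\<C> \<in> ?P" if "\<C> \<noteq> {}" "subset.chain ?P \<C>" for \<C>
    proof -
      have "pairwise almost_disjoint (\<Union>\<C>)"
        using that(2) by (intro pairwise_chain_Union)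
          (auto simp: ad_family_def subset_chain_def chain_subset_def)
      with that show ?thesis
        by (auto simp: ad_family_def subset_chain_def)
    qed
  qed
  then obtain \<A> where \<A>: "\<A> \<in> ?P" "\<forall>\<B>\<in>?P. \<A> \<subseteq> \<B> \<longrightarrow> \<B> = \<A>"
    by (rule bexE)
  then have "mad_family \<A>"
    unfolding mad_family_def by auto
  moreover have "infinite \<A>"
    using \<open>inj X\<close> \<A>(1) by (auto dest: finite_subset finite_imageD)
  ultimately show ?thesis by blast
qed

text \<open>The indices \<open>k\<close> code finite histories of choices, so \<open>B\<close> and
  \<open>h\<close> can be fixed before \<open>g\<close>. The width bound may fail at short histories
  and is therefore claimed only at the captured \<open>k\<close>.\<close>

lemma mad_family_slalom_infinitely_often:
  assumes mad: "mad_family \<A>" and X0: "X0 \<in> \<A>" and X1: "X1 \<in> \<A>" and "X0 \<noteq> X1"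
  obtains B :: "'v set \<Rightarrow> nat \<Rightarrow> nat set" and h :: "nat \<Rightarrow> nat"
  where "\<And>g. \<exists>X\<in>\<A>. infinite {k. g k \<in> B X k \<and> finite (B X k) \<and> card (B X k) \<le> h k}"
proof -
  have block: "block_subspace X" if "X \<in> \<A>" for X
    using mad that by (auto simp: mad_family_def ad_family_def)
  have fin: "finite_dim (X \<inter> Y)" if "X \<in> \<A>" "Y \<in> \<A>" "X \<noteq> Y" for X Y
    using mad that by (auto simp: mad_family_def ad_family_def pairwise_def almost_disjoint_def)
  obtain a where a: "block_sequence a" and X0_eq: "X0 = span (range a)"
    using block[OF X0] by (auto simp: block_subspace_def)
  obtain b where b: "block_sequence b" and X1_eq: "X1 = span (range b)"
    using block[OF X1] by (auto simp: block_subspace_def)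
  have sub_X1: "subspace X1"
    by (simp add: X1_eq)
  obtain N where N: "\<And>v. v \<in> X0 \<Longrightarrow> v \<in> X1 \<Longrightarrow> supp v \<subseteq> {..<N}"
  proof -
    obtain C where C: "finite C" "span C = X0 \<inter> X1"
      using fin[OF X0 X1 \<open>X0 \<noteq> X1\<close>] by (auto simp: finite_dim_def)
    then obtain N where "(\<Union>v\<in>C. supp v) \<subseteq> {..<N}"
      using finite_nat_bounded[of "\<Union>v\<in>C. supp v"] by auto
    then have "supp v \<subseteq> {..<N}" if "v \<in> X0" "v \<in> X1" for v
      using that C(2) supp_span_subset[of C "{..<N}" v] by (simp add: UN_subset_iff)
    then show ?thesis by (rule that)
  qed
  \<comment> \<open>Combinations of the \<open>a k\<close> with \<open>k \<ge> N\<close> have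
    support in \<open>{N..}\<close>, vectors of \<open>X0 \<inter> X1\<close> have support below
    \<open>N\<close>.\<close>
  have tail: "v = 0" if "v \<in> span (a ` {N..})" "v \<in> X1" for v
  proof -
    have "supp (a k) \<subseteq> {N..}" if "N \<le> k" for k
      using block_sequence_supp_ge[OF a, of k] that by (meson atLeast_subset_iff order_trans)
    then have "supp v \<subseteq> {N..}"
      by (intro supp_span_subset[OF _ that(1)]) auto
    moreover have "supp v \<subseteq> {..<N}"
    proof (rule N[OF _ that(2)])
      show "v \<in> X0"
        using that(1) unfolding X0_eq by (rule subsetD[OF span_mono, rotated]) auto
    qed
    ultimately have "supp v \<subseteq> {N..} \<inter> {..<N}"
      by (rule Int_greatest)
    also have "\<dots> = {}"
      by auto
    finally show ?thesis by simp
  qed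
  \<comment> \<open>If \<open>a p = v + w\<close> with \<open>v \<in> X1\<close>, then
    \<open>v = a p - w\<close> combines blocks from index \<open>N\<close> on, so
    \<open>v = 0\<close> and \<open>a p\<close> depends on earlier blocks.\<close>
  have a_notin: "a p \<notin> span (X1 \<union> a ` Q)" if "Q \<subseteq> {N..<p}" "N \<le> p" for p Q
  proof
    assume "a p \<in> span (X1 \<union> a ` Q)"
    then obtain v w where vw: "a p = v + w" "v \<in> X1" "w \<in> span (a ` Q)"
      using span_eq_iff[THEN iffD2, OF sub_X1] by (auto simp: span_Un)
    have "w \<in> span (a ` {N..})"
      using vw(3) by (rule subsetD[OF span_mono, rotated]) (use that(1) in auto)
    then have "a p - w \<in> span (a ` {N..})"
      using that(2) by (intro span_diff) (auto intro: span_base)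
    then have "v = 0"
      using tail[of v] vw(1,2) by simp
    then have "a p \<in> span (a ` Q)"
      using vw(1,3) by simp
    then have "a p \<in> span (a ` {..<p})"
      by (rule subsetD[OF span_mono, rotated]) (use that(1) in auto)
    with block_sequence_notin_span[OF a] show False by blast
  qed

  text \<open>
    A history \<open>s\<close> lists the earlier choices, the latest first. It determines a block \<open>a (P s)\<close> beyond
    the vectors \<open>Y s\<close> chosen so far; the next vector \<open>u s j\<close> adds to it the \<open>j\<close>-th available block
    of \<open>X1\<close>.
  \<close>
  define M where "M x = Suc (Max (insert 0 (supp x)))" for x
  have M: "supp x \<subseteq> {..<M x}" for x
    by (auto simp: M_def less_Suc_eq_le)
  \<comment> \<open>\<open>Suc r\<close> makes positions strictly increasing, and \<open>M\<close>
    moves past the support of the last vector; blocks of \<open>a\<close> and \<open>b\<close> of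
    index at least \<open>r\<close> are supported in \<open>{r..}\<close>.\<close>
  define P where "P = rec_list N (\<lambda>j _ r. max (Suc r) (M (a r + b (r + j))))"
  define u where "u s j = a (P s) + b (P s + j)" for s j
  define Y where "Y = rec_list {} (\<lambda>j s. insert (u s j))"
  have P_Nil: "P [] = N" and P_Cons: "P (j # s) = max (Suc (P s)) (M (u s j))" for j s
    by (simp_all add: P_def u_def)
  have Y_Nil: "Y [] = {}" and Y_Cons: "Y (j # s) = insert (u s j) (Y s)" for j s
    by (simp_all add: Y_def)
  have fin_Y: "finite (Y s)" for s
    by (induction s) (simp_all add: Y_Nil Y_Cons)
  have card_Y: "card (Y s) \<le> length s" for s
    by (induction s) (simp_all add: Y_Nil Y_Cons card_insert_if fin_Y)
  define B where "B X k = {j. u (from_nat k) j \<in> span (X \<union> Y (from_nat k))}" for X k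
  \<comment> \<open>Once the history is at least as long as \<open>card C\<close>, its length bounds
    both \<open>card C\<close> and \<open>card (Y s)\<close>; the extra one is the base point of the
    differences.\<close>
  define h where "h k = Suc (2 * length (from_nat k :: nat list))" for k

  have slalom: "\<exists>d. \<forall>k. d \<le> length (from_nat k :: nat list) \<longrightarrow>
      finite (B X k) \<and> card (B X k) \<le> h k" if X: "X \<in> \<A>" "X \<noteq> X1" for X
  proof -
    have "finite_dim (X1 \<inter> span X)"
      using fin[OF X1 X(1)] X(2) block_subspace_subspace[OF block[OF X(1)]]
      by (simp add: span_eq_iff[THEN iffD2])
    then obtain C where C: "finite C" "X1 \<inter> span X \<subseteq> span C"
      by (auto simp: finite_dim_def)
    have "finite (B X k) \<and> card (B X k) \<le> h k"
      if k: "card C \<le> length (from_nat k :: nat list)" for k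
    proof -
      let ?s = "from_nat k :: nat list"
      obtain C' where C': "finite C'" "card C' \<le> card C + card (Y ?s)"
        "X1 \<inter> span (X \<union> Y ?s) \<subseteq> span C'"
        using Int_span_Un_finite_subset_span[OF sub_X1 fin_Y C] by blast
      have "inj (\<lambda>j. b (P ?s + j))"
        using block_sequence_inj[OF b] by (simp add: inj_def) (metis add_left_cancel)
      moreover have "independent (range (\<lambda>j. b (P ?s + j)))"
        using block_sequence_independent[OF b] by (rule independent_mono) auto
      moreover have "range (\<lambda>j. b (P ?s + j)) \<subseteq> X1"
        by (auto simp: X1_eq intro: span_base)
      ultimately have "finite (B X k) \<and> card (B X k) \<le> Suc (card C')"
        unfolding B_def u_def using sub_X1 C'(3,1) by (intro card_affine_translates_in_span_le)
      then show ?thesis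
        using C'(2) card_Y[of ?s] k by (simp add: h_def)
    qed
    then show ?thesis by blast
  qed

  have "\<exists>X\<in>\<A>. infinite {k. g k \<in> B X k \<and> finite (B X k) \<and> card (B X k) \<le> h k}" for g
  proof -
    \<comment> \<open>Here \<open>g\<close> acts as a strategy: its value at the code of a history
      is the next choice, and \<open>S\<close> is the resulting branch.\<close>
    define S where "S = rec_nat [] (\<lambda>_ s. g (to_nat s) # s)"
    have S_0: "S 0 = []" and S_Suc: "S (Suc n) = g (to_nat (S n)) # S n" for n
      by (simp_all add: S_def)
    have len_S: "length (S n) = n" for n
      by (induction n) (simp_all add: S_0 S_Suc)
    define p where "p n = P (S n)" for n
    define y where "y n = u (S n) (g (to_nat (S n)))" for n
    have p_Suc: "p (Suc n) = max (Suc (p n)) (M (y n))" for n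
      by (simp add: p_def y_def S_Suc P_Cons)
    have Y_S: "Y (S n) = y ` {..<n}" for n
      by (induction n) (simp_all add: S_0 S_Suc Y_Nil Y_Cons y_def lessThan_Suc)
    have p_ge: "N \<le> p n" for n
      by (induction n) (simp_all add: p_Suc le_SucI max.coboundedI1, simp add: p_def S_0 P_Nil)
    have p_mono: "p m < p n" if "m < n" for m n
      using that by (rule lift_Suc_mono_less[rotated]) (simp add: p_Suc)
    have y_minus_a: "y n - a (p n) \<in> X1" for n
      by (auto simp: y_def u_def p_def X1_eq intro: span_base)
    \<comment> \<open>Modulo \<open>X1\<close> each \<open>y m\<close> equals
      \<open>a (p m)\<close>, and these blocks have increasing indices from \<open>N\<close>
      on.\<close>
    have y_notin_X1: "y n \<notin> span (X1 \<union> y ` {..<n})" for n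
    proof
      assume y_in: "y n \<in> span (X1 \<union> y ` {..<n})"
      let ?V = "span (X1 \<union> a ` p ` {..<n})"
      have "y m \<in> ?V" if "m < n" for m
      proof -
        have "y m - a (p m) \<in> ?V" "a (p m) \<in> ?V"
          using that y_minus_a by (auto intro: span_base)
        from span_add[OF this] show ?thesis by simp
      qed
      then have "X1 \<union> y ` {..<n} \<subseteq> ?V"
        by (auto intro: span_base)
      with y_in have "y n \<in> ?V"
        using span_minimal subspace_span by blast
      moreover have "y n - a (p n) \<in> ?V"
        using y_minus_a by (auto intro: span_base)
      ultimately have "y n - (y n - a (p n)) \<in> ?V"
        by (rule span_diff)
      then have "a (p n) \<in> ?V" by simp
      moreover have "p ` {..<n} \<subseteq> {N..<p n}"
        using p_ge p_mono by auto
      ultimately show False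
        using a_notin[OF _ p_ge] by blast
    qed
    have supp_y: "supp (y n) \<subseteq> {p n..<p (Suc n)}" for n
    proof -
      have "supp (y n) \<subseteq> supp (a (p n)) \<union> supp (b (p n + g (to_nat (S n))))"
        unfolding y_def u_def p_def by (rule supp_add)
      also have "\<dots> \<subseteq> {p n..}"
        using block_sequence_supp_ge[OF a, of "p n"]
          block_sequence_supp_ge[OF b, of "p n + g (to_nat (S n))"] by auto
      finally show ?thesis
        using M[of "y n"] by (fastforce simp: p_Suc)
    qed
    have y_nz: "y n \<noteq> 0" for n
      using y_notin_X1[of n] span_zero by metis
    have "Max (supp (y n)) < Min (supp (y (Suc n)))" for n
    proof -
      have "Max (supp (y n)) \<in> supp (y n)" "Min (supp (y (Suc n))) \<in> supp (y (Suc n))"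
        using y_nz by (auto intro!: Max_in Min_in)
      with supp_y[of n] supp_y[of "Suc n"] show ?thesis by fastforce
    qed
    with y_nz have y: "block_sequence y"
      by (simp add: block_sequence_def vec_less_def)
    then have block_y: "block_subspace (span (range y))"
      by (auto simp: block_subspace_def)
    have "\<exists>X\<in>\<A>. \<not> finite_dim (X \<inter> span (range y))"
    proof (rule ccontr)
      assume "\<not> ?thesis"
      then have fin_y: "finite_dim (X \<inter> span (range y))" if "X \<in> \<A>" for X
        using that by blast
      \<comment> \<open>Otherwise \<open>X = span (range y)\<close> would make a block subspace
        finite-dimensional.\<close>
      then have "span (range y) \<notin> \<A>"
        using block_subspace_infinite_dim[OF block_y] by fastforce
      moreover have "pairwise almost_disjoint (insert (span (range y)) \<A>)"
        using mad fin_y block block_y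
        by (auto simp: pairwise_insert almost_disjoint_block_iff Int_commute mad_family_def ad_family_def)
      then have "ad_family (insert (span (range y)) \<A>)"
        using block block_y by (auto simp: ad_family_def)
      ultimately show False
        using mad unfolding mad_family_def by blast
    qed
    then obtain X where X: "X \<in> \<A>" and inf_y: "\<not> finite_dim (X \<inter> span (range y))"
      by blast
    have sub_X: "subspace X"
      using X block block_subspace_subspace by blast
    define Z where "Z = {n. y n \<in> span (X \<union> y ` {..<n})}"
    have "infinite Z"
    proof
      assume "finite Z"
      then obtain n0 where "Z \<subseteq> {..<n0}"
        using finite_nat_bounded by blast
      then have "X \<inter> span (range y) \<subseteq> span (y ` {..<n0})"
        using sub_X by (intro Int_span_range_subset_span) (auto simp: Z_def)
      then have "finite_dim (X \<inter> span (range y))"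
        using sub_X by (subst finite_dim_iff) (auto intro: subspace_inter)
      with inf_y show False ..
    qed
    then have "X \<noteq> X1"
      using y_notin_X1 by (auto simp: Z_def)
    then obtain d where d: "\<And>k. d \<le> length (from_nat k :: nat list) \<Longrightarrow>
        finite (B X k) \<and> card (B X k) \<le> h k"
      using slalom[OF X] by blast
    \<comment> \<open>The width bound needs histories of length at least \<open>d\<close>. Histories
      of different lengths have different codes, so infinitely many \<open>k\<close> remain.\<close>
    have "infinite (Z - {..<d})"
      using \<open>infinite Z\<close> by simp
    moreover have "inj S"
      using len_S by (metis injI)
    then have "inj (\<lambda>n. to_nat (S n))"
      by (simp add: inj_def)
    ultimately have "infinite ((\<lambda>n. to_nat (S n)) ` (Z - {..<d}))"
      by (metis finite_imageD inj_on_subset subset_UNIV)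
    moreover have "(\<lambda>n. to_nat (S n)) ` (Z - {..<d}) \<subseteq>
        {k. g k \<in> B X k \<and> finite (B X k) \<and> card (B X k) \<le> h k}"
    proof (rule image_subsetI)
      fix n assume n: "n \<in> Z - {..<d}"
      then have "g (to_nat (S n)) \<in> B X (to_nat (S n))"
        by (simp add: B_def Z_def Y_S y_def)
      with d[of "to_nat (S n)"] n show "to_nat (S n) \<in>
          {k. g k \<in> B X k \<and> finite (B X k) \<and> card (B X k) \<le> h k}"
        by (simp add: len_S)
    qed
    ultimately show ?thesis
      using X infinite_super by blast
  qed
  then show ?thesis
    by (rule that)
qed

theorem non_M_le_a_vec: "non_M \<le>o a_vec"
proof -
  \<comment> \<open>The value of \<open>min_card\<close> is attained only for a nonempty
    family.\<close>
  have "{\<A>. infinite \<A> \<and> mad_family \<A>} \<noteq> {}"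
    using infinite_mad_family_exists by auto
  from min_card(1)[OF this] obtain \<A> where inf: "infinite \<A>" and mad: "mad_family \<A>"
    and eq: "a_vec = |\<A>|"
    by (auto simp: a_vec_def)
  obtain X0 where "X0 \<in> \<A>"
    using inf by fastforce
  moreover from inf have "infinite (\<A> - {X0})"
    by simp
  then obtain X1 where "X1 \<in> \<A>" "X0 \<noteq> X1"
    by (metis DiffE finite.emptyI insertCI subsetI subset_empty)
  ultimately obtain B :: "'v set \<Rightarrow> nat \<Rightarrow> nat set" and h :: "nat \<Rightarrow> nat" where
    B: "\<And>g. \<exists>X\<in>\<A>. infinite {k. g k \<in> B X k \<and> finite (B X k) \<and> card (B X k) \<le> h k}"
    using mad_family_slalom_infinitely_often[OF mad] by blast
  obtain F :: "'v set \<Rightarrow> nat \<Rightarrow> nat" where "\<And>g. \<exists>X\<in>\<A>. infinite {n. F X n = g n}"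
    using slalom_imp_infinitely_often_equal[OF B] by metis
  from infinitely_often_equal_imp_nonmeager[OF inf this]
  obtain S :: "real set" where S: "\<not> meager S" "|S| \<le>o |\<A>|"
    by blast
  then have "non_M \<le>o |S|"
    unfolding non_M_def by (intro min_card(2)) auto
  with S(2) show ?thesis
    unfolding eq by (rule ordLeq_transitive[rotated])
qed

end

theorem corollary2p11:
  fixes scale :: "'f::field \<Rightarrow> 'v::ab_group_add \<Rightarrow> 'v"
    and e :: "nat \<Rightarrow> 'v"
  assumes "countable (UNIV :: 'f set)"
    and "vector_space_nat_basis scale e"
  shows "non_M \<le>o vector_space_nat_basis.a_vec scale e"
  using assms(2) by (rule vector_space_nat_basis.non_M_le_a_vec)

end
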